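(* For a variable $s$ let $S_2(s)=\{s^{(2)}_k(s)\}_{k\in\mathbb{N}}$ be the sequence $s^{(2)}_k(s)=-B_k(s)/k$, where $B_k(s)$ is the $k$th Bernoulli polynomial. Then for every odd $j\in\mathbb{N}$, $p_{j,S_2(s)}(1-j)\equiv0$ (identically in $s$).
   Context: $\mathbb{N}=\{1,2,\dots\}$, $\mathbb{N}_0=\mathbb{N}\cup\{0\}$. For a sequence $S=\{s_k\}_{k\in\mathbb{N}}$ and $j\in\mathbb{N}_0$, $$p_{j,S}(t):=\sum_{k=0}^j\frac{(-1)^k}{k!}\widehat{B}_{j,k}(s_1,\dots,s_{j-k+1})\,t^k,$$ where $\widehat{B}_{n,k}$ are the partial ordinary Bell polynomials $$\widehat{B}_{n,k}(z_1,\dots,z_{n-k+1})=\sum\frac{k!}{j_1!j_2!\cdots j_{n-k+1}!}z_1^{j_1}\cdots z_{n-k+1}^{j_{n-k+1}},$$ the sum being over all nonnegative integers $j_1,\dots,j_{n-k+1}$ with $j_1+\cdots+j_{n-k+1}=k$ and $j_1+2j_2+\cdots+(n-k+1)j_{n-k+1}=n$ (so $\widehat B_{0,0}=1$ and $\widehat B_{n,0}=0$ for $n\ge1$). *)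

theory Defs
  imports "HOL-Computational_Algebra.Formal_Power_Series"
begin

(* A multi-index (j_1, ..., j_{n-k+1}) is a function on nat that vanishes outside {1..n-k+1}.
   For k > n the subtraction truncates, but then no multi-index satisfies both sum conditions. *)
definition bell_indices :: "nat \<Rightarrow> nat \<Rightarrow> (nat \<Rightarrow> nat) set" where
  "bell_indices n k = {j. (\<forall>i. i \<notin> {1..n - k + 1} \<longrightarrow> j i = 0) \<and>
      (\<Sum>i = 1..n - k + 1. j i) = k \<and> (\<Sum>i = 1..n - k + 1. i * j i) = n}"

lemma finite_bell_indices: "finite (bell_indices n k)"
proof (rule finite_subset)
  show "bell_indices n k \<subseteq>
      {j. \<forall>i. (i \<in> {1..n - k + 1} \<longrightarrow> j i \<in> {..k}) \<and> (i \<notin> {1..n - k + 1} \<longrightarrow> j i = 0)}"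
  proof
    fix j assume j: "j \<in> bell_indices n k"
    have "j i \<le> k" if "i \<in> {1..n - k + 1}" for i
      using j member_le_sum[of i "{1..n - k + 1}" j] that unfolding bell_indices_def by simp
    then show "j \<in> {j. \<forall>i. (i \<in> {1..n - k + 1} \<longrightarrow> j i \<in> {..k}) \<and> (i \<notin> {1..n - k + 1} \<longrightarrow> j i = 0)}"
      using j unfolding bell_indices_def by blast
  qed
  show "finite {j. \<forall>i. (i \<in> {1..n - k + 1} \<longrightarrow> j i \<in> {..k}) \<and> (i \<notin> {1..n - k + 1} \<longrightarrow> j i = (0::nat))}"
    by (rule finite_set_of_finite_funs) auto
qed

(* Partial ordinary Bell polynomial in the variables z 1, ..., z (n - k + 1); z 0 is not used. *)
definition ordinary_bell :: "nat \<Rightarrow> nat \<Rightarrow> (nat \<Rightarrow> 'a) \<Rightarrow> 'a :: field_char_0" where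
  "ordinary_bell n k z = (\<Sum>j \<in> bell_indices n k.
      fact k / (\<Prod>i = 1..n - k + 1. fact (j i)) * (\<Prod>i = 1..n - k + 1. z i ^ j i))"

definition p_poly :: "nat \<Rightarrow> (nat \<Rightarrow> 'a) \<Rightarrow> 'a \<Rightarrow> 'a :: field_char_0" where
  "p_poly j S t = (\<Sum>k = 0..j. (- 1) ^ k / fact k * ordinary_bell j k S * t ^ k)"

(* Generating function X e^{sX} / (e^X - 1) = (\<Sum>k. B_k(s) X^k / k!), so B_1(s) = s - 1/2. *)
definition bernoulli_poly :: "nat \<Rightarrow> 'a \<Rightarrow> 'a :: field_char_0" where
  "bernoulli_poly k s = fact k * fps_nth (fps_X * fps_exp s / (fps_exp 1 - 1)) k"

lemma bernoulli_poly_generating_function: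
  fixes s :: "'a :: field_char_0"
  shows "Abs_fps (\<lambda>k. bernoulli_poly k s / fact k) * (fps_exp 1 - 1) = fps_X * fps_exp s"
proof -
  have nz: "fps_nth (fps_exp 1 - 1 :: 'a fps) 1 \<noteq> 0" by simp
  then have sub: "subdegree (fps_exp 1 - 1 :: 'a fps) \<le> 1" by (rule subdegree_leI)
  have ne: "(fps_exp 1 - 1 :: 'a fps) \<noteq> 0" using nz by (metis fps_zero_nth)
  have "subdegree (fps_X * fps_exp s) \<ge> 1"
    by (rule subdegree_geI) (auto simp: fps_eq_iff intro: exI[of _ 1])
  with sub ne have "fps_exp 1 - 1 dvd fps_X * fps_exp s"
    by (subst fps_dvd_iff) auto
  moreover have "Abs_fps (\<lambda>k. bernoulli_poly k s / fact k) = fps_X * fps_exp s / (fps_exp 1 - 1)"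
    by (simp add: bernoulli_poly_def fps_eq_iff)
  ultimately show ?thesis by simp
qed

(* Only the values at k \<ge> 1 are meaningful. *)
definition S2 :: "'a \<Rightarrow> nat \<Rightarrow> 'a :: field_char_0" where
  "S2 s k = - bernoulli_poly k s / of_nat k"

end

theory Submission
  imports Defs "HOL-Computational_Algebra.Polynomial"
begin

text \<open>
  Let \<open>f = - (\<Sum>k\<ge>1. B\<^sub>k(s) x\<^sup>k / k)\<close>. The partial
  ordinary Bell polynomial with indices \<open>j, k\<close>, taken at the coefficients of \<open>f\<close>, is the
  coefficient of \<open>x\<^sup>j\<close> in \<open>f\<^sup>k\<close>, so \<open>p\<^sub>j(t)\<close> is the coefficient of
  \<open>x\<^sup>j\<close> in \<open>exp (- t f)\<close> (lemma \<open>p_poly_eq_exp_nth\<close>).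
  Put \<open>t = - \<nu>\<close> and \<open>F = exp (\<nu> f)\<close>, and consider how \<open>F\<close> depends on \<open>s\<close>.

  From \<open>B\<^sub>k' = k B\<^sub>k\<^sub>-\<^sub>1\<close> one gets the differential equation
  \<open>\<partial>F/\<partial>s = x\<^sup>2 \<partial>F/\<partial>x - \<nu> x F\<close>. In terms of the coefficients
  \<open>a\<^sub>m\<close> of \<open>F\<close>, which are polynomials in \<open>s\<close>, it says
  \<open>a\<^sub>m\<^sub>+\<^sub>1' = (m - \<nu>) a\<^sub>m\<close> (lemma \<open>pderiv_bernoulli_exp_Suc\<close>).
  Hence for \<open>\<nu> = j - 1\<close>, which is the point \<open>t = 1 - j\<close>, the coefficient \<open>a\<^sub>j\<close> does not
  depend on \<open>s\<close>. On the other hand \<open>B\<^sub>k(1 - s) = (- 1)\<^sup>k B\<^sub>k(s)\<close> means that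
  replacing \<open>s\<close> by \<open>1 - s\<close> has the same effect on \<open>F\<close> as replacing \<open>x\<close> by \<open>- x\<close>, so it
  multiplies \<open>a\<^sub>j\<close> by \<open>(- 1)\<^sup>j\<close> (lemma \<open>poly_bernoulli_exp_reflect\<close>). For odd
  \<open>j\<close> a constant equal to its own negative remains, and that is 0.
\<close>

section \<open>Bell polynomials as coefficients of powers\<close>

text \<open>
  The index range of a Bell polynomial depends on \<open>n\<close> and \<open>k\<close>, which obstructs a recurrence between
  Bell polynomials with different indices. Here the set \<open>A\<close> of admissible part sizes is a free
  parameter, so that it can stay fixed while \<open>n\<close> and \<open>k\<close> vary.
\<close>

definition weighted_compositions :: "nat set \<Rightarrow> nat \<Rightarrow> nat \<Rightarrow> (nat \<Rightarrow> nat) set" where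
  "weighted_compositions A k n =
     {j. (\<forall>i. i \<notin> A \<longrightarrow> j i = 0) \<and> (\<Sum>i\<in>A. j i) = k \<and> (\<Sum>i\<in>A. i * j i) = n}"

lemma finite_weighted_compositions:
  assumes "finite A"
  shows "finite (weighted_compositions A k n)"
proof (rule finite_subset)
  show "weighted_compositions A k n \<subseteq>
      {j. \<forall>i. (i \<in> A \<longrightarrow> j i \<in> {..k}) \<and> (i \<notin> A \<longrightarrow> j i = 0)}"
    using member_le_sum[of _ A] assms by (fastforce simp: weighted_compositions_def)
  show "finite {j. \<forall>i. (i \<in> A \<longrightarrow> j i \<in> {..k}) \<and> (i \<notin> A \<longrightarrow> j i = (0::nat))}"
    using assms by (intro finite_set_of_finite_funs) auto
qed

text \<open>
  Admitting further part sizes adds no multi-index, since \<open>k\<close> positive parts of total size \<open>n\<close> are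
  each at most \<open>n - k + 1\<close>.
\<close>

lemma bell_indices_eq_weighted_compositions:
  assumes "n - k + 1 \<le> N"
  shows "bell_indices n k = weighted_compositions {1..N} k n"
proof (rule set_eqI)
  fix j
  have iff: "j \<in> bell_indices n k \<longleftrightarrow> j \<in> weighted_compositions {1..N} k n"
    if supp: "\<forall>i. i \<notin> {1..n - k + 1} \<longrightarrow> j i = 0"
  proof -
    have "sum j {1..N} = sum j {1..n - k + 1}"
      using assms supp by (intro sum.mono_neutral_right) auto
    moreover have "(\<Sum>i = 1..N. i * j i) = (\<Sum>i = 1..n - k + 1. i * j i)"
      using assms supp by (intro sum.mono_neutral_right) auto
    moreover have "\<forall>i. i \<notin> {1..N} \<longrightarrow> j i = 0" using assms supp by auto
    ultimately show ?thesis
      using supp unfolding bell_indices_def weighted_compositions_def mem_Collect_eq by metis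
  qed
  show "j \<in> bell_indices n k \<longleftrightarrow> j \<in> weighted_compositions {1..N} k n"
  proof (cases "\<forall>i. i \<notin> {1..n - k + 1} \<longrightarrow> j i = 0")
    case True
    then show ?thesis by (rule iff)
  next
    case False
    then obtain i where i: "i \<notin> {1..n - k + 1}" and nz: "j i \<noteq> 0" by blast
    have "j \<notin> weighted_compositions {1..N} k n"
    proof
      assume j: "j \<in> weighted_compositions {1..N} k n"
      then have out: "\<forall>i. i \<notin> {1..N} \<longrightarrow> j i = 0" and k: "(\<Sum>l = 1..N. j l) = k"
        and n: "(\<Sum>l = 1..N. l * j l) = n"
        by (simp_all add: weighted_compositions_def)
      from out nz have iN: "i \<in> {1..N}" by metis
      with i have big: "i > n - k + 1" by auto
      \<comment> \<open>A part of size \<open>i\<close> together with \<open>k - 1\<close> further parts, each at least 1, exceeds \<open>n\<close>; in the sum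
        below each part contributes its size minus 1.\<close>
      have "(\<Sum>l = 1..N. l * j l) = (\<Sum>l = 1..N. j l + (l - 1) * j l)"
      proof (intro sum.cong refl)
        fix l assume "l \<in> {1..N}"
        then show "l * j l = j l + (l - 1) * j l" by (cases l) auto
      qed
      then have "n = k + (\<Sum>l = 1..N. (l - 1) * j l)"
        unfolding sum.distrib k n .
      moreover have "(i - 1) * j i \<le> (\<Sum>l = 1..N. (l - 1) * j l)"
        using iN by (intro member_le_sum) auto
      moreover have "(i - 1) * 1 \<le> (i - 1) * j i" using nz by (intro mult_left_mono) auto
      ultimately show False using big by linarith
    qed
    moreover have "j \<notin> bell_indices n k" using False unfolding bell_indices_def by blast
    ultimately show ?thesis by blast
  qed
qed

text \<open>
  Dividing the Bell polynomial by \<open>k!\<close> turns the multinomial weights into a product over the part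
  sizes, and lowering one exponent then changes a single factor.
\<close>

definition divided_bell :: "nat set \<Rightarrow> nat \<Rightarrow> nat \<Rightarrow> (nat \<Rightarrow> 'a) \<Rightarrow> 'a :: field_char_0" where
  "divided_bell A k n z = (\<Sum>j\<in>weighted_compositions A k n. \<Prod>i\<in>A. z i ^ j i / fact (j i))"

lemma ordinary_bell_eq_divided_bell:
  assumes "n - k + 1 \<le> N"
  shows "ordinary_bell n k z = fact k * divided_bell {1..N} k n z"
proof -
  have "fact k / (\<Prod>i = 1..n - k + 1. fact (j i)) * (\<Prod>i = 1..n - k + 1. z i ^ j i)
      = fact k * (\<Prod>i = 1..N. z i ^ j i / fact (j i))" if "j \<in> bell_indices n k" for j
  proof -
    have "(\<Prod>i = 1..N. z i ^ j i / fact (j i)) = (\<Prod>i = 1..n - k + 1. z i ^ j i / fact (j i))"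
      using that assms by (intro prod.mono_neutral_right) (auto simp: bell_indices_def)
    then show ?thesis by (simp add: prod_dividef)
  qed
  then show ?thesis
    unfolding ordinary_bell_def divided_bell_def bell_indices_eq_weighted_compositions[OF assms]
    by (simp add: sum_distrib_left)
qed

text \<open>
  Since \<open>q \<cdot> z\<^sup>q / q! = z \<cdot> z\<^sup>q\<^sup>-\<^sup>1 / (q - 1)!\<close>, weighting a multi-index by its
  number of parts of size \<open>i\<close> amounts to removing one such part.
\<close>

lemma divided_bell_remove_part:
  assumes "finite A" "i \<in> A"
  shows "(\<Sum>j\<in>weighted_compositions A (Suc k) n. of_nat (j i) * (\<Prod>l\<in>A. z l ^ j l / fact (j l)))
       = (if i \<le> n then z i * divided_bell A k (n - i) z else 0)"
proof -
  let ?T = "\<lambda>j. \<Prod>l\<in>A. z l ^ j l / fact (j l)"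
  let ?W = "{j \<in> weighted_compositions A (Suc k) n. j i \<noteq> 0}"
  have T: "?T j = z i ^ j i / fact (j i) * (\<Prod>l\<in>A - {i}. z l ^ j l / fact (j l))" for j
    using assms by (intro prod.remove)
  have S: "(\<Sum>l\<in>A. c l * j l) = c i * j i + (\<Sum>l\<in>A - {i}. c l * j l)" for c j :: "nat \<Rightarrow> nat"
    using assms by (intro sum.remove)
  note S1 = S[of "\<lambda>_. 1", simplified]
  have "(\<Sum>j\<in>weighted_compositions A (Suc k) n. of_nat (j i) * ?T j) = (\<Sum>j\<in>?W. of_nat (j i) * ?T j)"
    by (intro sum.mono_neutral_right) (auto simp: finite_weighted_compositions assms)
  also have "\<dots> = (if i \<le> n then z i * divided_bell A k (n - i) z else 0)"
  proof (cases "i \<le> n")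
    case True
    have "(\<Sum>j\<in>?W. of_nat (j i) * ?T j) = (\<Sum>j\<in>weighted_compositions A k (n - i). z i * ?T j)"
    proof (rule sum.reindex_bij_witness[where i = "\<lambda>j. j(i := Suc (j i))" and j = "\<lambda>j. j(i := j i - 1)"])
      fix j assume j: "j \<in> ?W"
      then obtain m where m: "j i = Suc m" by (cases "j i") auto
      show "(j(i := j i - 1))(i := Suc ((j(i := j i - 1)) i)) = j" using m by auto
      show "j(i := j i - 1) \<in> weighted_compositions A k (n - i)"
        using j m assms S[of "\<lambda>l. l" j] S[of "\<lambda>l. l" "j(i := j i - 1)"] S1[of j] S1[of "j(i := j i - 1)"]
        by (auto simp: weighted_compositions_def)
      show "z i * ?T (j(i := j i - 1)) = of_nat (j i) * ?T j"
        using m unfolding T by (simp add: field_simps del: of_nat_Suc)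
    next
      fix j assume j: "j \<in> weighted_compositions A k (n - i)"
      show "(j(i := Suc (j i)))(i := (j(i := Suc (j i))) i - 1) = j" by auto
      show "j(i := Suc (j i)) \<in> ?W"
        using j assms True S[of "\<lambda>l. l" j] S[of "\<lambda>l. l" "j(i := Suc (j i))"] S1[of j] S1[of "j(i := Suc (j i))"]
        by (auto simp: weighted_compositions_def)
    qed
    then show ?thesis using True by (simp add: divided_bell_def sum_distrib_left)
  next
    case False
    have "j i = 0" if "j \<in> weighted_compositions A (Suc k) n" for j
    proof (rule ccontr)
      assume "j i \<noteq> 0"
      then have "i \<le> i * j i" by simp
      also have "\<dots> \<le> (\<Sum>l\<in>A. l * j l)" using assms by (intro member_le_sum) auto
      also have "\<dots> = n" using that by (simp add: weighted_compositions_def)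
      finally show False using False by contradiction
    qed
    then have "?W = {}" by simp
    then show ?thesis using False by (simp only: sum.empty if_False)
  qed
  finally show ?thesis .
qed

text \<open>
  The number of parts \<open>k + 1\<close> is the sum over \<open>i\<close> of the numbers of parts of size \<open>i\<close>, and each of
  these weights is absorbed by removing a part. Up to the factor \<open>k!\<close>, this is the recurrence that
  multiplication by a power series imposes on the coefficients of its powers.
\<close>

lemma divided_bell_Suc:
  assumes "finite A"
  shows "of_nat (Suc k) * divided_bell A (Suc k) n z =
    (\<Sum>i\<in>A. if i \<le> n then z i * divided_bell A k (n - i) z else 0)"
proof -
  have "of_nat (Suc k) * divided_bell A (Suc k) n z =
      (\<Sum>j\<in>weighted_compositions A (Suc k) n. (\<Sum>i\<in>A. of_nat (j i)) * (\<Prod>l\<in>A. z l ^ j l / fact (j l)))"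
    unfolding divided_bell_def sum_distrib_left
    by (intro sum.cong refl) (simp add: weighted_compositions_def flip: of_nat_sum)
  also have "\<dots> = (\<Sum>i\<in>A. \<Sum>j\<in>weighted_compositions A (Suc k) n.
      of_nat (j i) * (\<Prod>l\<in>A. z l ^ j l / fact (j l)))"
    unfolding sum_distrib_right by (rule sum.swap)
  also have "\<dots> = (\<Sum>i\<in>A. if i \<le> n then z i * divided_bell A k (n - i) z else 0)"
    by (intro sum.cong refl divided_bell_remove_part assms)
  finally show ?thesis .
qed

lemma divided_bell_0:
  assumes "finite A"
  shows "divided_bell A 0 n z = (if n = 0 then 1 else 0)"
proof -
  have "weighted_compositions A 0 n = (if n = 0 then {\<lambda>_. 0} else {})"
    using assms by (auto simp: weighted_compositions_def fun_eq_iff)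
  then show ?thesis by (simp add: divided_bell_def)
qed

definition ogf :: "(nat \<Rightarrow> 'a) \<Rightarrow> 'a :: zero fps" where
  "ogf z = Abs_fps (\<lambda>i. if i = 0 then 0 else z i)"

lemma ogf_power_nth:
  assumes "n \<le> N"
  shows "fps_nth (ogf z ^ k) n = fact k * divided_bell {1..N} k n z"
  using assms
proof (induction k arbitrary: n)
  case 0
  show ?case by (simp add: divided_bell_0)
next
  case (Suc k)
  have "fps_nth (ogf z ^ Suc k) n = (\<Sum>i=0..n. fps_nth (ogf z) i * fps_nth (ogf z ^ k) (n - i))"
    by (simp add: fps_mult_nth)
  also have "\<dots> = (\<Sum>i=0..n. if i = 0 then 0 else z i * (fact k * divided_bell {1..N} k (n - i) z))"
    using Suc.prems by (intro sum.cong refl, subst Suc.IH) (auto simp: ogf_def)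
  also have "\<dots> = (\<Sum>i=1..N. if i \<le> n then z i * (fact k * divided_bell {1..N} k (n - i) z) else 0)"
    using Suc.prems by (intro sum.mono_neutral_cong) auto
  also have "\<dots> = fact k * (\<Sum>i=1..N. if i \<le> n then z i * divided_bell {1..N} k (n - i) z else 0)"
    unfolding sum_distrib_left by (intro sum.cong refl) auto
  also have "\<dots> = fact (Suc k) * divided_bell {1..N} (Suc k) n z"
    by (subst divided_bell_Suc[symmetric]) (auto simp: algebra_simps)
  finally show ?case .
qed

lemma ordinary_bell_eq_ogf_power_nth: "ordinary_bell n k z = fps_nth (ogf z ^ k) n"
  using ordinary_bell_eq_divided_bell[of n k "Suc n" z] ogf_power_nth[of n "Suc n" z k] by simp

lemma p_poly_eq_exp_nth: "p_poly j S t = fps_nth (fps_exp (- t) oo ogf S) j"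
  unfolding p_poly_def fps_compose_nth ordinary_bell_eq_ogf_power_nth
  by (intro sum.cong refl) (simp add: power_minus[of t])

text \<open>
  The coefficients of the differential equation \<open>E' = - t f' E\<close> of \<open>E = exp (- t f)\<close>, where
  \<open>f\<close> is the series \<open>ogf S\<close>. With the initial value 1 it determines all values of \<open>p_poly\<close>
  without reference to Bell polynomials.
\<close>

lemma p_poly_recurrence:
  "of_nat (Suc m) * p_poly (Suc m) S t
     = - t * (\<Sum>k=0..m. of_nat (Suc k) * S (Suc k) * p_poly (m - k) S t)"
proof -
  let ?E = "fps_exp (- t) oo ogf S"
  have "fps_deriv ?E = fps_const (- t) * (fps_deriv (ogf S) * ?E)"
    by (subst fps_compose_deriv) (simp_all add: ogf_def fps_compose_mult_distrib algebra_simps)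
  then have "fps_nth (fps_deriv ?E) m = - t * fps_nth (fps_deriv (ogf S) * ?E) m"
    by (metis fps_mult_left_const_nth)
  then show ?thesis
    by (simp add: p_poly_eq_exp_nth fps_mult_nth ogf_def)
qed

section \<open>Bernoulli polynomials\<close>

text \<open>
  The Bernoulli polynomial as a formal polynomial, so that it can be differentiated over an arbitrary
  field of characteristic 0. The coefficients come from comparing the generating functions at \<open>s\<close> and
  at 0, which differ by the factor \<open>exp (s x)\<close>.
\<close>

definition bernoulli :: "nat \<Rightarrow> 'a :: field_char_0 poly" where
  "bernoulli k = (\<Sum>i\<le>k. monom (of_nat (k choose i) * bernoulli_poly (k - i) 0) i)"

lemma bernoulli_poly_egf:
  fixes s :: "'a :: field_char_0"
  shows "Abs_fps (\<lambda>k. bernoulli_poly k s / fact k)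
       = fps_exp s * Abs_fps (\<lambda>k. bernoulli_poly k 0 / fact k)" (is "?B s = _ * ?B 0")
proof -
  have "(fps_exp 1 - 1 :: 'a fps) \<noteq> 0"
    by (auto simp: fps_eq_iff intro!: exI[of _ 1])
  moreover have "?B s * (fps_exp 1 - 1) = (fps_exp s * ?B 0) * (fps_exp 1 - 1)"
    using bernoulli_poly_generating_function[of s] bernoulli_poly_generating_function[of "0::'a"]
    by (simp add: mult.assoc mult.commute)
  ultimately show ?thesis by (metis mult_right_cancel)
qed

lemma poly_bernoulli: "poly (bernoulli k) s = bernoulli_poly k s"
proof -
  have "bernoulli_poly k s / fact k = (\<Sum>i\<le>k. s ^ i / fact i * (bernoulli_poly (k - i) 0 / fact (k - i)))"
    using arg_cong[OF bernoulli_poly_egf[of s], of "\<lambda>f. fps_nth f k"]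
    by (simp add: fps_mult_nth atMost_atLeast0)
  then have "bernoulli_poly k s = fact k * (\<Sum>i\<le>k. s ^ i / fact i * (bernoulli_poly (k - i) 0 / fact (k - i)))"
    by (simp add: field_simps)
  also have "\<dots> = poly (bernoulli k) s"
    by (simp add: bernoulli_def poly_sum poly_monom sum_distrib_left binomial_fact field_simps)
  finally show ?thesis by simp
qed

lemma bernoulli_0: "bernoulli 0 = 1"
proof -
  have "bernoulli_poly 0 0 = (1::'a)"
    using arg_cong[OF bernoulli_poly_generating_function[of "0::'a"], of "\<lambda>f. fps_nth f 1"]
    by (simp add: fps_mult_nth)
  then show ?thesis by (simp add: bernoulli_def)
qed

lemma pderiv_sum: "pderiv (sum f A) = (\<Sum>i\<in>A. pderiv (f i))"
  using higher_pderiv_sum[of 1 f A] by simp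

lemma smult_sum_right: "smult c (sum f A) = (\<Sum>i\<in>A. smult c (f i))"
  by (induction A rule: infinite_finite_induct) (simp_all add: smult_add_right)

lemma pderiv_bernoulli_Suc:
  "pderiv (bernoulli (Suc k)) = smult (of_nat (Suc k)) (bernoulli k)"
proof -
  have "pderiv (bernoulli (Suc k) :: 'a poly) =
      (\<Sum>i\<le>Suc k. monom (of_nat i * (of_nat (Suc k choose i) * bernoulli_poly (Suc k - i) 0)) (i - 1))"
    unfolding bernoulli_def pderiv_sum pderiv_monom ..
  also have "\<dots> = (\<Sum>i\<le>k. monom (of_nat (Suc i) * (of_nat (Suc k choose Suc i) * bernoulli_poly (k - i) 0)) i)"
    by (subst sum.atMost_Suc_shift) simp
  also have "\<dots> = (\<Sum>i\<le>k. smult (of_nat (Suc k)) (monom (of_nat (k choose i) * bernoulli_poly (k - i) 0) i))"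
  proof (intro sum.cong refl)
    fix i
    have "of_nat (Suc i) * (of_nat (Suc k choose Suc i) :: 'a) = of_nat (Suc k) * of_nat (k choose i)"
      by (metis Suc_times_binomial_eq of_nat_mult mult.commute)
    then show "monom (of_nat (Suc i) * (of_nat (Suc k choose Suc i) * bernoulli_poly (k - i) (0::'a))) i
        = smult (of_nat (Suc k)) (monom (of_nat (k choose i) * bernoulli_poly (k - i) 0) i)"
      by (simp add: smult_monom mult.assoc[symmetric] del: of_nat_Suc)
  qed
  also have "\<dots> = smult (of_nat (Suc k)) (bernoulli k)"
    by (simp add: bernoulli_def smult_sum_right)
  finally show ?thesis .
qed

text \<open>
  Substituting \<open>- x\<close> in \<open>x exp (s x) / (exp x - 1)\<close> and expanding the fraction by \<open>exp x\<close> gives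
  \<open>x exp ((1 - s) x) / (exp x - 1)\<close>.
\<close>

lemma bernoulli_poly_reflect:
  fixes s :: "'a :: field_char_0"
  shows "bernoulli_poly k (1 - s) = (- 1) ^ k * bernoulli_poly k s"
proof -
  let ?B = "\<lambda>s :: 'a. Abs_fps (\<lambda>k. bernoulli_poly k s / fact k)"
  let ?R = "?B s oo - fps_X"
  have ne: "(fps_exp 1 - 1 :: 'a fps) \<noteq> 0"
    by (auto simp: fps_eq_iff intro!: exI[of _ 1])
  have "?R * (fps_exp (- 1) - 1) = - fps_X * fps_exp (- s)"
    using arg_cong[OF bernoulli_poly_generating_function[of s], of "\<lambda>f. f oo - fps_X"]
    by (simp add: fps_compose_mult_distrib fps_compose_sub_distrib)
  then have "?R * (fps_exp (- 1) - 1) * fps_exp 1 = - fps_X * fps_exp (- s) * fps_exp 1"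
    by simp
  then have "?R * (fps_exp (- 1) * fps_exp 1 - fps_exp 1) = - (fps_X * (fps_exp (- s) * fps_exp 1))"
    by (simp only: algebra_simps minus_mult_left mult_1)
  then have "?R * (1 - fps_exp 1) = - (fps_X * fps_exp (1 - s))"
    by (simp flip: fps_exp_add_mult)
  then have "?R * (fps_exp 1 - 1) = ?B (1 - s) * (fps_exp 1 - 1)"
    unfolding bernoulli_poly_generating_function by (simp add: algebra_simps)
  with ne have "?B (1 - s) = ?R" by simp
  from arg_cong[OF this, of "\<lambda>f. fps_nth f k"] show ?thesis
    by (simp add: fps_compose_uminus' field_simps)
qed

section \<open>The dependence on the Bernoulli parameter\<close>

text \<open>
  The coefficients of \<open>exp (- \<nu> (\<Sum>k\<ge>1. B\<^sub>k(s) x\<^sup>k / k))\<close> as formal polynomials in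
  \<open>s\<close>; the recursion is that of \<open>p_poly_recurrence\<close>.
\<close>

fun bernoulli_exp :: "'a \<Rightarrow> nat \<Rightarrow> 'a :: field_char_0 poly" where
  "bernoulli_exp \<nu> 0 = 1"
| "bernoulli_exp \<nu> (Suc m) =
     smult (- \<nu> / of_nat (Suc m)) (\<Sum>k\<le>m. bernoulli (Suc k) * bernoulli_exp \<nu> (m - k))"

declare bernoulli_exp.simps(2) [simp del]

lemma bernoulli_exp_recurrence:
  "smult (of_nat (Suc m)) (bernoulli_exp \<nu> (Suc m))
     = smult (- \<nu>) (\<Sum>k\<le>m. bernoulli (Suc k) * bernoulli_exp \<nu> (m - k))"
  by (simp add: bernoulli_exp.simps(2) del: of_nat_Suc)

lemma p_poly_S2_eq_bernoulli_exp: "p_poly m (S2 s) (- \<nu>) = poly (bernoulli_exp \<nu> m) s"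
proof (induction m rule: less_induct)
  case (less m)
  show ?case
  proof (cases m)
    case 0
    then show ?thesis by (simp add: p_poly_eq_exp_nth)
  next
    case (Suc m')
    have "of_nat (Suc m') * p_poly (Suc m') (S2 s) (- \<nu>)
        = \<nu> * (\<Sum>k\<le>m'. - bernoulli_poly (Suc k) s * poly (bernoulli_exp \<nu> (m' - k)) s)"
      unfolding p_poly_recurrence atMost_atLeast0 minus_minus
    proof (intro arg_cong2[where f = "(*)"] sum.cong refl)
      fix k
      show "of_nat (Suc k) * S2 s (Suc k) = - bernoulli_poly (Suc k) s"
        by (simp add: S2_def del: of_nat_Suc)
      show "p_poly (m' - k) (S2 s) (- \<nu>) = poly (bernoulli_exp \<nu> (m' - k)) s"
        using less Suc by simp
    qed
    also have "\<dots> = poly (smult (of_nat (Suc m')) (bernoulli_exp \<nu> (Suc m'))) s"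
      unfolding bernoulli_exp_recurrence by (simp add: poly_sum poly_bernoulli sum_negf)
    finally show ?thesis using Suc by (simp del: of_nat_Suc)
  qed
qed

text \<open>
  Every product in the recursion for the coefficient of \<open>x\<^sup>m\<close> has total weight \<open>m\<close>, so the
  signs from the reflection of the Bernoulli polynomials multiply to \<open>(- 1)\<^sup>m\<close>.
\<close>

lemma poly_bernoulli_exp_reflect:
  "poly (bernoulli_exp \<nu> m) (1 - s) = (- 1) ^ m * poly (bernoulli_exp \<nu> m) s"
proof (induction m rule: less_induct)
  case (less m)
  show ?case
  proof (cases m)
    case (Suc m')
    have "poly (bernoulli (Suc k)) (1 - s) * poly (bernoulli_exp \<nu> (m' - k)) (1 - s)
        = (- 1) ^ m * (poly (bernoulli (Suc k)) s * poly (bernoulli_exp \<nu> (m' - k)) s)"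
      if "k \<le> m'" for k
    proof -
      have "(- 1 :: 'a) ^ m = (- 1) ^ Suc k * (- 1) ^ (m' - k)"
        using that Suc by (simp flip: power_add)
      then show ?thesis
        using less[of "m' - k"] Suc by (simp add: poly_bernoulli bernoulli_poly_reflect)
    qed
    then show ?thesis
      using Suc by (simp add: bernoulli_exp.simps(2) poly_sum sum_distrib_left mult.left_commute
          del: of_nat_Suc power_Suc)
  qed simp
qed

text \<open>
  Write \<open>a\<^sub>m\<close> for \<open>bernoulli_exp \<nu> m\<close>. Differentiating the recursion lowers the
  index of one factor in each product. After a shift of the summation index all products are of the form \<open>B\<^sub>k a\<^sub>m\<^sub>-\<^sub>k\<close>, with coefficient \<open>k + 1\<close>
  from the derivative of the Bernoulli polynomial and, by induction, \<open>m - k - \<nu>\<close> from the other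
  factor. Their sum \<open>m + 1 - \<nu>\<close> does not depend on \<open>k\<close>, so the recursion for \<open>a\<^sub>m\<close> itself
  evaluates what remains. The product with \<open>k = 0\<close> occurs only in the first way and is kept apart.
\<close>

lemma pderiv_bernoulli_exp_Suc:
  "pderiv (bernoulli_exp \<nu> (Suc m)) = smult (of_nat m - \<nu>) (bernoulli_exp \<nu> m)"
proof (induction m rule: less_induct)
  case (less m)
  let ?a = "bernoulli_exp \<nu>"
  let ?\<Sigma> = "\<Sum>k<m. bernoulli (Suc k) * ?a (m - Suc k)"
  have \<Sigma>: "smult \<nu> ?\<Sigma> = - smult (of_nat m) (?a m)"
  proof (cases m)
    case (Suc m')
    then show ?thesis using bernoulli_exp_recurrence[of m' \<nu>]
      by (simp add: lessThan_Suc_atMost del: of_nat_Suc)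
  qed simp
  have "pderiv (\<Sum>k\<le>m. bernoulli (Suc k) * ?a (m - k))
      = (\<Sum>k\<le>m. smult (of_nat (Suc k)) (bernoulli k * ?a (m - k)))
        + (\<Sum>k\<le>m. bernoulli (Suc k) * pderiv (?a (m - k)))"
    by (simp add: pderiv_sum pderiv_mult pderiv_bernoulli_Suc sum.distrib algebra_simps
        del: of_nat_Suc)
  also have "(\<Sum>k\<le>m. smult (of_nat (Suc k)) (bernoulli k * ?a (m - k)))
      = ?a m + (\<Sum>k<m. smult (of_nat k + 2) (bernoulli (Suc k) * ?a (m - Suc k)))"
    by (cases m) (simp_all add: sum.atMost_Suc_shift bernoulli_0 lessThan_Suc_atMost add.commute 
       del: sum.atMost_Suc)
  also have "(\<Sum>k\<le>m. bernoulli (Suc k) * pderiv (?a (m - k)))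
      = (\<Sum>k<m. bernoulli (Suc k) * pderiv (?a (m - k)))"
    by (simp flip: lessThan_Suc_atMost)
  also have "\<dots> = (\<Sum>k<m. smult (of_nat m - of_nat k - 1 - \<nu>) (bernoulli (Suc k) * ?a (m - Suc k)))"
  proof (intro sum.cong refl)
    fix k assume "k \<in> {..<m}"
    then show "bernoulli (Suc k) * pderiv (?a (m - k))
        = smult (of_nat m - of_nat k - 1 - \<nu>) (bernoulli (Suc k) * ?a (m - Suc k))"
      using less[of "m - Suc k"] by (simp add: Suc_diff_Suc of_nat_diff algebra_simps)
  qed
  also have "?a m + (\<Sum>k<m. smult (of_nat k + 2) (bernoulli (Suc k) * ?a (m - Suc k))) + \<dots>
      = ?a m + smult (of_nat m + 1 - \<nu>) ?\<Sigma>"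
    by (simp add: add.assoc smult_sum_right flip: sum.distrib smult_add_left)
      (simp add: algebra_simps)
  finally have "smult (of_nat (Suc m)) (pderiv (?a (Suc m)))
      = smult (- \<nu>) (?a m + smult (of_nat m + 1 - \<nu>) ?\<Sigma>)"
    using arg_cong[OF bernoulli_exp_recurrence[of m \<nu>], of pderiv]
    by (simp only: pderiv_smult)
  also have "\<dots> = smult (- \<nu>) (?a m) - smult (of_nat m + 1 - \<nu>) (smult \<nu> ?\<Sigma>)"
    by (simp add: smult_add_right mult.commute)
  also have "\<dots> = smult (of_nat (Suc m)) (smult (of_nat m - \<nu>) (?a m))"
    unfolding \<Sigma> by (simp add: algebra_simps flip: smult_add_left smult_diff_left)
  finally show ?case by (metis of_nat_neq_0 smult_cancel)
qed

theorem corollary2p5: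
  fixes s :: "'a :: field_char_0" and j :: nat
  assumes "odd j"
  shows "p_poly j (S2 s) (1 - of_nat j) = 0"
proof -
  from assms obtain n where j: "j = Suc n" by (cases j) auto
  let ?a = "bernoulli_exp (of_nat n :: 'a) j"
  have "pderiv ?a = 0" unfolding j pderiv_bernoulli_exp_Suc by simp
  then obtain c where c: "?a = [:c:]" by (metis pderiv_eq_0_iff degree_eq_zeroE)
  \<comment> \<open>The reflection carries the parameter 0 to 1, and a constant takes the same value at both.\<close>
  have "c = - c"
    using poly_bernoulli_exp_reflect[of "of_nat n :: 'a" j 0] assms unfolding c by simp
  then have "c = 0" by simp
  moreover have "p_poly j (S2 s) (1 - of_nat j) = poly ?a s"
    using p_poly_S2_eq_bernoulli_exp[of j s "of_nat n"] j by simp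
  ultimately show ?thesis using c by simp
qed

end
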